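(* Let $d\in\mathbb{N}$, $L=\mathbb{T}^n_{\le d}$, and let $M=\bigcup_i M_i\subseteq K[x_1,\dots,x_n]$ be a finite set of polynomials, all elements of $M_i$ having degree exactly $i$, which generates a zero-dimensional ideal $I$. Assume that $M$ is $L$-stabilized and in canonical form, and that $\langle M\rangle_K^{\le d}/\langle M\rangle_K^{\le d-1}\cong\langle\mathbb{T}^n_{=d}\rangle_K$. Then the order ideal polytope $P(M,L)\subseteq[0,1]^L$ of $I$ is given by the following system of inequalities in the variables $z_m$, $m\in L$: (a) $z_{m_1}\ge z_{m_2}$ for all $m_1,m_2\in L$ with $m_1\mid m_2$; (b) $\sum_{m\in L^{=i}}z_m=\dim\langle L^{=i}\rangle_K-\dim\langle\mathrm{LF}(M_i)\rangle_K$ for all $i\in[d-1]$; (c) $\sum_{m\in U}z_m\ge|U|-\operatorname{rk}(\tilde U)$ for all $i\in[d-1]$ and all $U\subseteq L^{=i}$ with $|U|=\dim\langle\mathrm{LF}(M_i)\rangle_K$, where $\tilde U$ is the submatrix, consisting of the columns indexed by $U$, of the matrix whose rows are the coefficient vectors of the elements of $\mathrm{LF}(M_i)$ with columns indexed by $L^{=i}$; (d) $z_m\in[0,1]$ for all $m\in L$.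
   Context: $K$ is a field, $\mathbb{N}=\{0,1,2,\dots\}$, $[k]=\{1,\dots,k\}$, and $\mathbb{T}^n$ is the set of monomials in $x_1,\dots,x_n$; $\mathbb{T}^n_{\le d}$, $\mathbb{T}^n_{=d}$ are those of total degree at most $d$, respectively exactly $d$; $L^{=i}=\{m\in L\mid\deg m=i\}$. $\langle S\rangle_K$ is the $K$-linear span. An ideal is zero-dimensional if its quotient ring is finite-dimensional over $K$. For a vector space $W$ of polynomials, $W^{\le i}=\{p\in W\mid\deg p\le i\}$ (including $0$), with $W^{\le-1}=0$. The leading form $\mathrm{LF}(p)$ of a polynomial $p$ is its homogeneous component of degree $\deg p$; $\mathrm{LF}(M_i)=\{\mathrm{LF}(p)\mid p\in M_i\}$. $M$ is $L$-stabilized if every element of $M$ is supported on $L$ and $\langle M^+\rangle_K\cap\langle L\rangle_K=\langle M\rangle_K$, where $M^+=M\cup Mx_1\cup\dots\cup Mx_n$. $M$ is in canonical form if one can choose for each element of $M$ a leading term, being any term of maximal degree in its support, such that the leading term of any element of $M$ does not occur in the support of the other elements of $M$. The order ideal polytope $P(I)$ of a zero-dimensional ideal $I$ is defined by the following system in variables $z_m$, $m\in\mathbb{T}^n$, where $I^{\le i}/I^{\le i-1}$ is identified with a subspace of $\langle\mathbb{T}^n_{=i}\rangle_K$ by sending the class of $p$ to its degree-$i$ homogeneous component: (1) $z_{m_1}\ge z_{m_2}$ for all $m_1,m_2\in\mathbb{T}^n$ with $m_1\mid m_2$; (2) $\sum_{m\in\mathbb{T}^n_{=i}}z_m=\dim\langle\mathbb{T}^n_{=i}\rangle_K-\dim(I^{\le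 i}/I^{\le i-1})$ for all $i$; (3) $\sum_{m\in U}z_m\le\dim\langle U\cup(I^{\le i}/I^{\le i-1})\rangle_K-\dim(I^{\le i}/I^{\le i-1})$ for all $i$ and all $U\subseteq\mathbb{T}^n_{=i}$ with $|U|=\dim\langle\mathbb{T}^n_{=i}\rangle_K-\dim(I^{\le i}/I^{\le i-1})$; (4) $z_m\in[0,1]$ for all $m\in\mathbb{T}^n$. In this system $z_m=0$ whenever the degree of $m$ is large enough, so $P(I)$ is a finite-dimensional polytope. $P(M,L)$ denotes the order ideal polytope of the ideal $I$ generated by $M$, written in the coordinates $z_m$ with $m\in L$.
   Formalization: Equation (b) is stated for all i in {0,…,d} rather than only i in [d-1]; as printed the claim fails, e.g. n=1, d=1, M={x}, where P(M,L) is the single point (z_1,z_x)=(1,0) but the printed system also admits (0,0) and (1,1). *)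

theory Defs
  imports Complex_Main "HOL-Library.Poly_Mapping" "HOL-Library.FuncSet" "HOL-Library.Function_Algebras"
begin

section \<open>Monomials and polynomials\<close>

text \<open>
  Monomials are represented by their finitely supported exponent functions, so the product of
  monomials is addition of exponents. The variables of the ring in \<open>n\<close> variables are
  indexed by \<open>{1..n}\<close>; it is the subring \<open>polys n\<close> of the ring of polynomials in
  variables indexed by all natural numbers.
\<close>

type_synonym monomial = "nat \<Rightarrow>\<^sub>0 nat"
type_synonym 'a mpol = "monomial \<Rightarrow>\<^sub>0 'a"

definition mdeg :: "monomial \<Rightarrow> nat" where
  "mdeg m = (\<Sum>v\<in>Poly_Mapping.keys m. Poly_Mapping.lookup m v)"

definition mdvd :: "monomial \<Rightarrow> monomial \<Rightarrow> bool" where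
  "mdvd m1 m2 \<longleftrightarrow> (\<exists>k. m2 = m1 + k)"

definition monoms :: "nat \<Rightarrow> monomial set" where
  "monoms n = {m. Poly_Mapping.keys m \<subseteq> {1..n}}"

definition monoms_le :: "nat \<Rightarrow> nat \<Rightarrow> monomial set" where
  "monoms_le n d = {m \<in> monoms n. mdeg m \<le> d}"

definition monoms_eq :: "nat \<Rightarrow> nat \<Rightarrow> monomial set" where
  "monoms_eq n d = {m \<in> monoms n. mdeg m = d}"

definition degree_part :: "monomial set \<Rightarrow> nat \<Rightarrow> monomial set" where
  "degree_part L i = {m \<in> L. mdeg m = i}"

definition polys :: "nat \<Rightarrow> 'a::field mpol set" where
  "polys n = {p. Poly_Mapping.keys p \<subseteq> monoms n}"

definition mpol_of_monom :: "monomial \<Rightarrow> 'a::field mpol" where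
  "mpol_of_monom m = Poly_Mapping.single m 1"

definition var :: "nat \<Rightarrow> 'a::field mpol" where
  "var v = mpol_of_monom (Poly_Mapping.single v 1)"

text \<open>The zero polynomial gets degree 0.\<close>

definition pdeg :: "'a::field mpol \<Rightarrow> nat" where
  "pdeg p = (if p = 0 then 0 else Max (mdeg ` Poly_Mapping.keys p))"

definition hom_comp :: "nat \<Rightarrow> 'a::field mpol \<Rightarrow> 'a mpol" where
  "hom_comp i p =
     (\<Sum>m \<in> {m \<in> Poly_Mapping.keys p. mdeg m = i}. Poly_Mapping.single m (Poly_Mapping.lookup p m))"

definition leading_form :: "'a::field mpol \<Rightarrow> 'a mpol" where
  "leading_form p = hom_comp (pdeg p) p"


section \<open>Linear algebra over the coefficient field\<close>

definition pscale :: "'a::field \<Rightarrow> 'a mpol \<Rightarrow> 'a mpol" where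
  "pscale c p = Poly_Mapping.map ((*) c) p"

lemma lookup_pscale: "Poly_Mapping.lookup (pscale c p) m = c * Poly_Mapping.lookup p m"
  by (simp add: pscale_def Poly_Mapping.map.rep_eq when_def)

global_interpretation pvs: vector_space pscale
  defines pspan = pvs.span and pdim = pvs.dim
  by unfold_locales
     (auto intro!: poly_mapping_eqI simp: lookup_pscale lookup_add algebra_simps)

definition linear_iso :: "'a::field mpol set \<Rightarrow> 'a mpol set \<Rightarrow> bool" where
  "linear_iso V W \<longleftrightarrow> (\<exists>f. bij_betw f V W
     \<and> (\<forall>x\<in>V. \<forall>y\<in>V. f (x + y) = f x + f y)
     \<and> (\<forall>c. \<forall>x\<in>V. f (pscale c x) = pscale c (f x)))"

text \<open>
  The quotient of \<open>{p \<in> W. deg p \<le> i}\<close> by \<open>{p \<in> W. deg p \<le> i - 1}\<close>,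
  realised inside the span of the monomials of degree \<open>i\<close> by sending the class of \<open>p\<close>
  to its homogeneous component of degree \<open>i\<close>.
\<close>

definition graded_piece :: "'a::field mpol set \<Rightarrow> nat \<Rightarrow> 'a mpol set" where
  "graded_piece W i = hom_comp i ` {p \<in> W. pdeg p \<le> i}"

global_interpretation fvs: vector_space "\<lambda>(c::'a::field) (f :: 'c \<Rightarrow> 'a) x. c * f x"
  by unfold_locales (auto simp: fun_eq_iff algebra_simps)

text \<open>
  Rank of the matrix with entries \<open>A r c\<close>, rows \<open>r \<in> R\<close> and columns \<open>c \<in> C\<close>: the dimension
  of the span of its rows, as for \<open>rank\<close> in HOL-Analysis, which needs types as index sets.
\<close>

definition mat_rank :: "'r set \<Rightarrow> 'c set \<Rightarrow> ('r \<Rightarrow> 'c \<Rightarrow> 'a::field) \<Rightarrow> nat" where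
  "mat_rank R C A = fvs.dim ((\<lambda>r c. if c \<in> C then A r c else 0) ` R)"


section \<open>Ideals\<close>

definition ideal_gen :: "nat \<Rightarrow> 'a::field mpol set \<Rightarrow> 'a mpol set" where
  "ideal_gen n M = {\<Sum>f\<in>F. c f * f | F c. finite F \<and> F \<subseteq> M \<and> (\<forall>f\<in>F. c f \<in> polys n)}"

text \<open>Finitely many residue classes span the quotient of \<open>polys n\<close> by \<open>I\<close>.\<close>

definition zero_dimensional :: "nat \<Rightarrow> 'a::field mpol set \<Rightarrow> bool" where
  "zero_dimensional n I \<longleftrightarrow>
     (\<exists>B. finite B \<and> B \<subseteq> polys n \<and> (\<forall>p \<in> polys n. \<exists>q \<in> pspan B. p - q \<in> I))"

definition M_plus :: "nat \<Rightarrow> 'a::field mpol set \<Rightarrow> 'a mpol set" where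
  "M_plus n M = M \<union> (\<Union>v\<in>{1..n}. (\<lambda>p. p * var v) ` M)"

definition stabilized :: "nat \<Rightarrow> monomial set \<Rightarrow> 'a::field mpol set \<Rightarrow> bool" where
  "stabilized n L M \<longleftrightarrow> (\<forall>p\<in>M. Poly_Mapping.keys p \<subseteq> L)
     \<and> pspan (M_plus n M) \<inter> pspan (mpol_of_monom ` L) = pspan M"

definition canonical_form :: "'a::field mpol set \<Rightarrow> bool" where
  "canonical_form M \<longleftrightarrow> (\<exists>lt :: 'a mpol \<Rightarrow> monomial.
     (\<forall>p\<in>M. lt p \<in> Poly_Mapping.keys p \<and> (\<forall>m \<in> Poly_Mapping.keys p. mdeg m \<le> mdeg (lt p)))
     \<and> (\<forall>p\<in>M. \<forall>q\<in>M. q \<noteq> p \<longrightarrow> lt p \<notin> Poly_Mapping.keys q))"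


section \<open>The order ideal polytope\<close>

definition order_ideal_polytope :: "nat \<Rightarrow> 'a::field mpol set \<Rightarrow> (monomial \<Rightarrow> real) set" where
  "order_ideal_polytope n I = {z \<in> monoms n \<rightarrow>\<^sub>E {0..1}.
     (\<forall>m1 \<in> monoms n. \<forall>m2 \<in> monoms n. mdvd m1 m2 \<longrightarrow> z m1 \<ge> z m2)
   \<and> (\<forall>i. (\<Sum>m \<in> monoms_eq n i. z m) =
          real (pdim (pspan (mpol_of_monom ` monoms_eq n i) :: 'a mpol set))
          - real (pdim (graded_piece I i)))
   \<and> (\<forall>i. \<forall>U \<subseteq> monoms_eq n i.
          real (card U) = real (pdim (pspan (mpol_of_monom ` monoms_eq n i) :: 'a mpol set))
            - real (pdim (graded_piece I i)) \<longrightarrow>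
          (\<Sum>m\<in>U. z m) \<le> real (pdim (pspan (mpol_of_monom ` U \<union> graded_piece I i)))
            - real (pdim (graded_piece I i)))}"

text \<open>
  The polytope of the ideal generated by \<open>M\<close>, in the coordinates belonging to \<open>L\<close>.
\<close>

definition order_ideal_polytope_on ::
    "nat \<Rightarrow> 'a::field mpol set \<Rightarrow> monomial set \<Rightarrow> (monomial \<Rightarrow> real) set" where
  "order_ideal_polytope_on n M L = (\<lambda>z. restrict z L) ` order_ideal_polytope n (ideal_gen n M)"

end

theory Submission
  imports Defs
begin

text \<open>
  Let \<open>V\<close> be the span of \<open>M\<close> and \<open>W\<close> the span of \<open>L\<close>. As \<open>V\<close> contains every form of degree \<open>d\<close> up to
  lower terms, there is a linear projection \<open>\<pi>\<close> of \<open>W\<close> with kernel \<open>V\<close> and image consisting of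
  polynomials of degree less than \<open>d\<close>. Since \<open>M\<close> is \<open>L\<close>-stabilized, the operators \<open>p \<mapsto> \<pi> (\<pi> p * x)\<close>,
  one for each variable \<open>x\<close>, commute, so they make the image of \<open>\<pi>\<close> a module over the polynomial ring.
  Acting on \<open>\<pi> 1\<close> extends \<open>\<pi>\<close> to all polynomials; the kernel is an ideal containing \<open>M\<close>.
  Hence the ideal \<open>I\<close> of \<open>M\<close> meets \<open>W\<close> exactly in \<open>V\<close>. In degree at most \<open>d\<close> the graded pieces of
  \<open>I\<close> are therefore those of \<open>V\<close>, which are spanned by leading forms because \<open>M\<close> is in canonical
  form; in degree at least \<open>d\<close> they are everything, which forces the coordinates outside \<open>L\<close> to
  vanish. The two families of rank inequalities are exchanged by taking complements of \<open>U\<close>.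
\<close>

subsection \<open>Degrees and supports\<close>

lemma mdeg_eq_sum:
  assumes "finite A" "Poly_Mapping.keys m \<subseteq> A"
  shows "mdeg m = (\<Sum>v\<in>A. Poly_Mapping.lookup m v)"
  unfolding mdeg_def using assms
  by (intro sum.mono_neutral_left) (auto simp: in_keys_iff)

lemma mdeg_add: "mdeg (a + b) = mdeg a + mdeg b"
proof -
  let ?A = "Poly_Mapping.keys a \<union> Poly_Mapping.keys b"
  have "mdeg (a + b) = (\<Sum>v\<in>?A. Poly_Mapping.lookup (a + b) v)"
    by (rule mdeg_eq_sum) (simp_all add: Poly_Mapping.keys_add)
  also have "\<dots> = mdeg a + mdeg b"
    by (simp add: lookup_add sum.distrib mdeg_eq_sum[of ?A])
  finally show ?thesis .
qed

lemma mdeg_single [simp]: "mdeg (Poly_Mapping.single v k) = k"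
  by (simp add: mdeg_def)

lemma mdeg_zero [simp]: "mdeg 0 = 0"
  by (simp add: mdeg_def)

lemma mdeg_eq_0_iff: "mdeg m = 0 \<longleftrightarrow> m = 0"
proof
  assume "mdeg m = 0"
  then have "Poly_Mapping.lookup m v = 0" for v
    by (cases "v \<in> Poly_Mapping.keys m") (simp_all add: mdeg_def in_keys_iff)
  then show "m = 0" by (intro poly_mapping_eqI) simp
qed simp

lemma keys_add_nat: "Poly_Mapping.keys (a + b) = Poly_Mapping.keys a \<union> Poly_Mapping.keys b"
  for a b :: monomial
  by (auto simp: in_keys_iff lookup_add)

lemma monoms_add_iff: "a + b \<in> monoms n \<longleftrightarrow> a \<in> monoms n \<and> b \<in> monoms n"
  by (simp add: monoms_def keys_add_nat)

lemma monoms_zero [simp]: "0 \<in> monoms n"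
  by (simp add: monoms_def)

lemma monoms_single [simp]: "v \<in> {1..n} \<Longrightarrow> Poly_Mapping.single v k \<in> monoms n"
  by (auto simp: monoms_def)

text \<open>Any variable occurring in \<open>m\<close> can be split off. This is the step of all
  later inductions on the degree of a monomial.\<close>

lemma monom_decompose:
  assumes "m \<in> monoms n" "m \<noteq> 0"
  obtains v m' where "v \<in> {1..n}" "m' \<in> monoms n" "m = m' + Poly_Mapping.single v 1"
    "mdeg m = Suc (mdeg m')"
proof -
  from assms(2) obtain v where v: "v \<in> Poly_Mapping.keys m"
    by (metis ex_in_conv keys_eq_empty)
  define m' where "m' = m - Poly_Mapping.single v 1"
  have m: "m = m' + Poly_Mapping.single v 1"
    using v by (intro poly_mapping_eqI)
      (auto simp: m'_def lookup_add lookup_minus lookup_single when_def in_keys_iff)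
  show ?thesis
  proof (rule that)
    show "v \<in> {1..n}" using v assms(1) by (auto simp: monoms_def)
    show "m' \<in> monoms n" using assms(1) m by (metis monoms_add_iff)
    show "m = m' + Poly_Mapping.single v 1" by (rule m)
    show "mdeg m = Suc (mdeg m')" using arg_cong[OF m, of mdeg] by (simp add: mdeg_add)
  qed
qed

text \<open>Variables are divided out one at a time until the degree has dropped to
  \<open>d\<close>.\<close>

lemma monom_split_degree:
  assumes "m \<in> monoms n" "d \<le> mdeg m"
  obtains m' t where "m' \<in> monoms_eq n d" "t \<in> monoms n" "m = m' + t"
proof -
  have "\<exists>m' t. m' \<in> monoms_eq n d \<and> t \<in> monoms n \<and> m = m' + t" using assms
  proof (induction "mdeg m - d" arbitrary: m)
    case 0
    then show ?case
      by (intro exI[of _ m] exI[of _ 0]) (auto simp: monoms_eq_def)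
  next
    case (Suc k)
    then have "m \<noteq> 0" by auto
    with Suc.prems(1) obtain v m1 where *: "v \<in> {1..n}" "m1 \<in> monoms n"
      "m = m1 + Poly_Mapping.single v 1" "mdeg m = Suc (mdeg m1)"
      by (rule monom_decompose)
    have "k = mdeg m1 - d" "d \<le> mdeg m1" using Suc.hyps(2) *(4) by auto
    from Suc.hyps(1)[OF this(1) *(2) this(2)] obtain m' t
      where "m' \<in> monoms_eq n d" "t \<in> monoms n" "m1 = m' + t" by blast
    then show ?case using *
      by (intro exI[of _ m'] exI[of _ "t + Poly_Mapping.single v 1"])
        (auto simp: monoms_add_iff add.assoc)
  qed
  then show ?thesis using that by blast
qed

lemma finite_monoms_le: "finite (monoms_le n d)"
proof (induction d)
  case 0
  have "monoms_le n 0 \<subseteq> {0}" by (auto simp: monoms_le_def mdeg_eq_0_iff)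
  then show ?case by (rule finite_subset) simp
next
  case (Suc d)
  have "monoms_le n (Suc d) \<subseteq>
    insert 0 ((\<lambda>(v, m). m + Poly_Mapping.single v 1) ` ({1..n} \<times> monoms_le n d))"
  proof
    fix m assume m: "m \<in> monoms_le n (Suc d)"
    show "m \<in> insert 0 ((\<lambda>(v, m). m + Poly_Mapping.single v 1) ` ({1..n} \<times> monoms_le n d))"
    proof (cases "m = 0")
      case False
      have "m \<in> monoms n" using m by (simp add: monoms_le_def)
      from this False obtain v m' where "v \<in> {1..n}" "m' \<in> monoms n"
        "m = m' + Poly_Mapping.single v 1" "mdeg m = Suc (mdeg m')"
        by (rule monom_decompose)
      then show ?thesis using m by (force simp: monoms_le_def)
    qed simp
  qed
  then show ?case by (rule finite_subset) (simp add: Suc.IH)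
qed

lemma finite_monoms_eq: "finite (monoms_eq n d)"
  by (rule finite_subset[OF _ finite_monoms_le[of n d]]) (auto simp: monoms_eq_def monoms_le_def)

section \<open>Homogeneous components and degrees of polynomials\<close>

lemma lookup_hom_comp:
  "Poly_Mapping.lookup (hom_comp i p) m = (if mdeg m = i then Poly_Mapping.lookup p m else 0)"
proof -
  let ?A = "{m \<in> Poly_Mapping.keys p. mdeg m = i}"
  have "Poly_Mapping.lookup (hom_comp i p) m
      = (\<Sum>k\<in>?A. if k = m then Poly_Mapping.lookup p k else 0)"
    by (simp add: hom_comp_def lookup_sum lookup_single when_def)
  also have "\<dots> = (if m \<in> ?A then Poly_Mapping.lookup p m else 0)"
    by (simp add: sum.delta)
  finally show ?thesis by (auto simp: in_keys_iff)
qed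

lemma keys_hom_comp:
  "Poly_Mapping.keys (hom_comp i p) = {m \<in> Poly_Mapping.keys p. mdeg m = i}"
  by (auto simp: in_keys_iff lookup_hom_comp split: if_splits)

text \<open>The convention \<open>pdeg 0 = 0\<close> makes this valid for the zero polynomial as
  well.\<close>

lemma pdeg_le_iff: "pdeg p \<le> i \<longleftrightarrow> (\<forall>m\<in>Poly_Mapping.keys p. mdeg m \<le> i)"
  by (auto simp: pdeg_def)

lemma hom_comp_eq_0: "pdeg p < i \<Longrightarrow> hom_comp i p = 0"
proof -
  assume *: "pdeg p < i"
  have "mdeg m < i" if "m \<in> Poly_Mapping.keys p" for m
    using * that pdeg_le_iff[of p "pdeg p"] by fastforce
  then have "Poly_Mapping.keys (hom_comp i p) = {}" by (auto simp: keys_hom_comp)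
  then show ?thesis by simp
qed

lemma pscale_eq_mult: "pscale c p = Poly_Mapping.single 0 c * p"
  by (simp add: pscale_def mult_map_scale_conv_mult)

subsection \<open>Spans of monomials\<close>

interpretation pvs2: vector_space_pair pscale pscale ..

text \<open>Linear maps from polynomials to functions: the setting for coefficient rows and their
  rank.\<close>

interpretation pfvs: vector_space_pair pscale "\<lambda>(c::'a::field) (f :: 'c \<Rightarrow> 'a) x. c * f x" ..

lemma keys_mpol_of_monom [simp]: "Poly_Mapping.keys (mpol_of_monom m :: 'a::field mpol) = {m}"
  by (simp add: mpol_of_monom_def)

lemma mpol_of_monom_add:
  "(mpol_of_monom (a + b) :: 'a::field mpol) = mpol_of_monom a * mpol_of_monom b"
  by (simp add: mpol_of_monom_def mult_single)

lemma inj_mpol_of_monom: "inj (mpol_of_monom :: monomial \<Rightarrow> 'a::field mpol)"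
  by (rule injI) (metis keys_mpol_of_monom singleton_inject)

text \<open>The polynomials supported on \<open>S\<close> form a subspace, and each is the sum of
  its terms. Below, this reduces membership in spans of monomials to inclusion of supports.\<close>

lemma in_span_monoms_iff:
  fixes p :: "'a::field mpol"
  shows "p \<in> pspan (mpol_of_monom ` S) \<longleftrightarrow> Poly_Mapping.keys p \<subseteq> S"
proof
  have "pvs.subspace {p :: 'a mpol. Poly_Mapping.keys p \<subseteq> S}"
    unfolding pvs.subspace_def
    by (auto simp: in_keys_iff lookup_pscale subset_iff lookup_add) (metis add.right_neutral)
  then have "pspan (mpol_of_monom ` S) \<subseteq> {p :: 'a mpol. Poly_Mapping.keys p \<subseteq> S}"
    by (intro pvs.span_minimal) auto
  then show "p \<in> pspan (mpol_of_monom ` S) \<Longrightarrow> Poly_Mapping.keys p \<subseteq> S" by blast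
next
  assume S: "Poly_Mapping.keys p \<subseteq> S"
  have "p = (\<Sum>m\<in>Poly_Mapping.keys p. pscale (Poly_Mapping.lookup p m) (mpol_of_monom m))"
    by (rule poly_mapping_eqI)
      (auto simp: lookup_sum lookup_pscale mpol_of_monom_def lookup_single when_def in_keys_iff
        if_distrib sum.delta cong: if_cong)
  also have "\<dots> \<in> pspan (mpol_of_monom ` S)"
    using S by (intro pvs.span_sum pvs.span_scale pvs.span_base) auto
  finally show "p \<in> pspan (mpol_of_monom ` S)" .
qed

lemma polys_eq_span: "polys n = pspan (mpol_of_monom ` monoms n)"
  by (auto simp: polys_def in_span_monoms_iff)

lemma independent_monoms: "pvs.independent (mpol_of_monom ` S :: 'a::field mpol set)"
proof
  assume "pvs.dependent (mpol_of_monom ` S :: 'a mpol set)"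
  then obtain m where m: "m \<in> S"
    "(mpol_of_monom m :: 'a mpol) \<in> pspan (mpol_of_monom ` S - {mpol_of_monom m})"
    by (auto simp: pvs.dependent_def)
  have "mpol_of_monom ` S - {mpol_of_monom m :: 'a mpol} = mpol_of_monom ` (S - {m})"
    using inj_mpol_of_monom by (auto simp: inj_def)
  with m(2) show False by (simp add: in_span_monoms_iff)
qed

lemma dim_span_monoms: "pdim (pspan (mpol_of_monom ` S) :: 'a::field mpol set) = card S"
  using card_image[OF inj_on_subset[OF inj_mpol_of_monom subset_UNIV]]
  by (metis independent_monoms pvs.dim_span_eq_card_independent)

lemma linear_mult_right: "Vector_Spaces.linear pscale pscale (\<lambda>p :: 'a::field mpol. p * q)"
  by unfold_locales (simp_all add: pscale_eq_mult algebra_simps)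

lemma linear_hom_comp: "Vector_Spaces.linear pscale pscale (hom_comp i :: 'a::field mpol \<Rightarrow> _)"
  by unfold_locales
    (auto intro!: poly_mapping_eqI simp: lookup_hom_comp lookup_add lookup_pscale)

lemma polys_mult:
  assumes "p \<in> polys n" "q \<in> polys n"
  shows "p * q \<in> polys n"
  using keys_mult[of p q] assms by (fastforce simp: polys_def monoms_add_iff)

lemma subspace_polys: "pvs.subspace (polys n)"
  by (simp add: polys_eq_span)

lemma mpol_of_monom_in_polys [simp]: "mpol_of_monom m \<in> polys n \<longleftrightarrow> m \<in> monoms n"
  by (simp add: polys_def)

subsection \<open>Stabilized spaces and the ideals they generate\<close>

lemma funpow_commute:
  assumes "\<And>x. f (g x) = g (f x)"
  shows "(f ^^ k) (g x) = g ((f ^^ k) x)"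
  by (induction k) (simp_all add: assms)

text \<open>Let each \<open>X v\<close> act on \<open>z\<close> as often as the exponent of
  \<open>v\<close> says, in a fixed order of the variables. Commutation moves one more
  \<open>X v\<close> to the outside.\<close>

lemma commuting_monomial_action:
  fixes X :: "nat \<Rightarrow> 'b \<Rightarrow> 'b"
  assumes comm: "\<And>u v x. u \<in> {1..n} \<Longrightarrow> v \<in> {1..n} \<Longrightarrow> X u (X v x) = X v (X u x)"
  obtains Y :: "monomial \<Rightarrow> 'b"
  where "Y 0 = z" "\<And>m v. v \<in> {1..n} \<Longrightarrow> Y (m + Poly_Mapping.single v 1) = X v (Y m)"
proof -
  \<comment> \<open>The list of variables is kept as a parameter so that the step can be proved by
    induction on it.\<close>
  define Y where
    "Y m vs = foldr (\<lambda>v. X v ^^ Poly_Mapping.lookup m v) vs z" for m :: monomial and vs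
  have Y_zero: "Y 0 vs = z" for vs
    by (induction vs) (simp_all add: Y_def)
  have notin: "Y (m + Poly_Mapping.single v 1) vs = Y m vs" if "v \<notin> set vs" for m v vs
    using that unfolding Y_def
    by (induction vs) (auto simp: lookup_add lookup_single)
  have step: "Y (m + Poly_Mapping.single v 1) vs = X v (Y m vs)"
    if "distinct vs" "set vs \<subseteq> {1..n}" "v \<in> set vs" for m v vs
    using that
  proof (induction vs)
    case (Cons u us)
    show ?case
    proof (cases "u = v")
      case True
      then have "Y (m + Poly_Mapping.single v 1) us = Y m us"
        using Cons.prems by (intro notin) auto
      then show ?thesis using True by (simp add: Y_def lookup_add)
    \<comment> \<open>Here the extra \<open>X v\<close> comes out of the tail and must pass the
      power of \<open>X u\<close>.\<close>
    next
      case False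
      then have "Y (m + Poly_Mapping.single v 1) us = X v (Y m us)"
        using Cons by auto
      then show ?thesis
        using False Cons.prems comm funpow_commute[of "X u" "X v" "Poly_Mapping.lookup m u"]
        by (auto simp: Y_def lookup_add lookup_single)
    qed
  qed simp
  show ?thesis
  proof (rule that[of "\<lambda>m. Y m [1..<Suc n]"])
    show "Y 0 [1..<Suc n] = z" by (rule Y_zero)
    show "v \<in> {1..n} \<Longrightarrow> Y (m + Poly_Mapping.single v 1) [1..<Suc n] = X v (Y m [1..<Suc n])" for m v
      by (rule step) auto
  qed
qed

text \<open>A border basis criterion: commuting multiplication operators on the normal forms show
  that the ideal acquires no new elements of degree at most \<open>d\<close>.\<close>

lemma stabilized_ideal_le:
  fixes M :: "'a::field mpol set"
  assumes sub: "M \<subseteq> polys n"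
    and stab: "stabilized n (monoms_le n d) M"
    and top: "mpol_of_monom ` monoms_eq n d \<subseteq> graded_piece (pspan M) d"
    and p: "p \<in> ideal_gen n M" and deg: "pdeg p \<le> d"
  shows "p \<in> pspan M"
proof -
  \<comment> \<open>The space for normal forms. The strict bound keeps the product of such a form
    with a variable inside \<open>W\<close>.\<close>
  define low :: "'a mpol set" where "low = pspan (mpol_of_monom ` {m \<in> monoms n. mdeg m < d})"
  define W :: "'a mpol set" where "W = pspan (mpol_of_monom ` monoms_le n d)"
  have low_W: "low \<subseteq> W"
    unfolding low_def W_def by (rule pvs.span_mono) (auto simp: monoms_le_def)
  have V_W: "pspan M \<subseteq> W"
    using stab unfolding stabilized_def W_def by blast
  \<comment> \<open>The nontrivial inclusion in the definition of stability.\<close>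
  have stabD: "p \<in> pspan M" if "p \<in> pspan (M_plus n M)" "p \<in> W" for p
    using stab that unfolding stabilized_def W_def by blast
  have mult_V: "p * var v \<in> pspan (M_plus n M)" if "p \<in> pspan M" "v \<in> {1..n}" for p v
  proof -
    have "p * var v \<in> (\<lambda>p. p * var v) ` pspan M" using that by blast
    also have "\<dots> = pspan ((\<lambda>p. p * var v) ` M)"
      by (rule pvs2.linear_span_image[OF linear_mult_right, symmetric])
    also have "\<dots> \<subseteq> pspan (M_plus n M)"
      using that by (intro pvs.span_mono) (auto simp: M_plus_def)
    finally show ?thesis .
  qed
  have mult_low: "p * var v \<in> W" if "p \<in> low" "v \<in> {1..n}" for p v
  proof -
    have "p * var v \<in> (\<lambda>p. p * var v) ` low" using that by blast
    also have "\<dots> = pspan ((\<lambda>p. p * var v) ` mpol_of_monom ` {m \<in> monoms n. mdeg m < d})"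
      unfolding low_def by (rule pvs2.linear_span_image[OF linear_mult_right, symmetric])
    also have "\<dots> \<subseteq> W"
      unfolding W_def using that
      by (intro pvs.span_minimal)
        (auto simp: in_span_monoms_iff var_def mpol_of_monom_add[symmetric] monoms_le_def
          monoms_add_iff mdeg_add)
    finally show ?thesis .
  qed

  \<comment> \<open>A basis \<open>B1\<close> of the span of \<open>M\<close> is extended by
    elements of \<open>low\<close>. The projection kills \<open>B1\<close> and fixes the added basis
    elements.\<close>
  obtain B1 where B1: "B1 \<subseteq> pspan M" "pvs.independent B1" "pspan M \<subseteq> pspan B1"
    by (rule pvs.maximal_independent_subset)
  obtain B where B: "B1 \<subseteq> B" "B \<subseteq> B1 \<union> low" "pvs.independent B" "B1 \<union> low \<subseteq> pspan B"
    by (rule pvs.maximal_independent_subset_extend[of B1 "B1 \<union> low"]) (use B1 in auto)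
  obtain \<pi> where \<pi>: "Vector_Spaces.linear pscale pscale \<pi>"
    and \<pi>_B: "\<forall>b\<in>B. \<pi> b = (if b \<in> B1 then 0 else b)"
    and \<pi>_range: "range \<pi> = pspan ((\<lambda>b. if b \<in> B1 then 0 else b) ` B)"
    using pvs2.linear_independent_extend_subspace[OF B(3), of "\<lambda>b. if b \<in> B1 then 0 else b"]
    by blast
  \<comment> \<open>The range is controlled for every argument, also outside \<open>W\<close>; hence
    the operators below commute on all polynomials.\<close>
  have \<pi>_low: "\<pi> p \<in> low" for p
  proof -
    have "\<pi> p \<in> range \<pi>" by blast
    also have "\<dots> \<subseteq> low"
      unfolding \<pi>_range using B(2)
      by (intro pvs.span_minimal) (auto simp: low_def pvs.span_zero)
    finally show ?thesis .
  qed
  have \<pi>_V: "\<pi> p = 0" if "p \<in> pspan M" for p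
    by (rule pvs2.linear_eq_0_on_span[OF \<pi>, of B1]) (use \<pi>_B B(1) B1(3) that in auto)
  have "pvs.subspace {p. p - \<pi> p \<in> pspan M}"
    unfolding pvs.subspace_def
  proof (intro conjI ballI allI; clarsimp)
    show "- \<pi> 0 \<in> pspan M" by (simp add: pvs2.linear_0[OF \<pi>] pvs.span_zero)
    show "x + y - \<pi> (x + y) \<in> pspan M" if "x - \<pi> x \<in> pspan M" "y - \<pi> y \<in> pspan M" for x y
      using pvs.span_add[OF that] by (simp add: pvs2.linear_add[OF \<pi>] algebra_simps)
    show "pscale c x - \<pi> (pscale c x) \<in> pspan M" if "x - \<pi> x \<in> pspan M" for c x
      using pvs.span_scale[OF that, of c]
      by (simp add: pvs2.linear_scale[OF \<pi>] pvs.scale_right_diff_distrib)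
  qed
  moreover have "B \<subseteq> {p. p - \<pi> p \<in> pspan M}"
    using \<pi>_B B1(1) by (auto simp: pvs.span_zero)
  ultimately have \<pi>_mod_B: "pspan B \<subseteq> {p. p - \<pi> p \<in> pspan M}"
    by (intro pvs.span_minimal)
  \<comment> \<open>A monomial of degree \<open>d\<close> is the top component of some
    \<open>q\<close> in the span of \<open>M\<close>, and differs from \<open>q\<close> by an
    element of \<open>low\<close>.\<close>
  have "W \<subseteq> pspan B"
    unfolding W_def
  proof (rule pvs.span_minimal; clarsimp)
    fix m assume m: "m \<in> monoms_le n d"
    show "mpol_of_monom m \<in> pspan B"
    proof (cases "mdeg m < d")
      case True
      then have "mpol_of_monom m \<in> low"
        using m by (auto simp: low_def in_span_monoms_iff monoms_le_def)
      then show ?thesis using B(4) by blast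
    next
      case False
      then have "m \<in> monoms_eq n d" using m by (auto simp: monoms_le_def monoms_eq_def)
      then obtain q where q: "q \<in> pspan M" "pdeg q \<le> d" "hom_comp d q = mpol_of_monom m"
        using top by (force simp: graded_piece_def)
      have "Poly_Mapping.keys q \<subseteq> monoms n"
        using subsetD[OF V_W q(1)] by (auto simp: W_def in_span_monoms_iff monoms_le_def)
      then have "q - hom_comp d q \<in> low"
        using q(2) by (auto simp: low_def in_span_monoms_iff pdeg_le_iff in_keys_iff lookup_minus
            lookup_hom_comp split: if_splits) (metis in_keys_iff nat_less_le)+
      then have "q - hom_comp d q \<in> pspan B" using B(4) by blast
      moreover have "q \<in> pspan B"
        using q(1) B1(3) pvs.span_mono[OF B(1)] by blast
      ultimately have "q - (q - hom_comp d q) \<in> pspan B" by (metis pvs.span_diff)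
      then show ?thesis by (simp add: q(3))
    qed
  qed
  with \<pi>_mod_B have \<pi>_mod: "p - \<pi> p \<in> pspan M" if "p \<in> W" for p
    using that by blast
  have \<pi>_cong: "\<pi> p = \<pi> q" if "p - q \<in> pspan M" for p q
    using \<pi>_V[OF that] by (simp add: pvs2.linear_diff[OF \<pi>])
  have \<pi>_idem: "\<pi> (\<pi> p) = \<pi> p" if "p \<in> W" for p
    using \<pi>_cong[OF \<pi>_mod[OF that]] by simp

  \<comment> \<open>The inner \<open>\<pi>\<close> turns an arbitrary argument into a normal form,
    so the product with the variable lies in \<open>W\<close>.\<close>
  define X where "X v p = \<pi> (\<pi> p * var v)" for v p
  have X_comm: "X u (X v p) = X v (X u p)" if u: "u \<in> {1..n}" and v: "v \<in> {1..n}" for u v p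
  proof -
    define c where "c = \<pi> p"
    define a where "a = \<pi> (c * var u)"
    define b where "b = \<pi> (c * var v)"
    have W: "c * var u \<in> W" "c * var v \<in> W"
      unfolding c_def by (intro mult_low \<pi>_low u v)+
    \<comment> \<open>Both reductions are multiplied by the other variable, so that the terms
      \<open>c * var u * var v\<close> cancel. What is left has degree at most \<open>d\<close>, and
      stability applies.\<close>
    have "(c * var u - a) * var v - (c * var v - b) * var u \<in> pspan (M_plus n M)"
      unfolding a_def b_def by (intro pvs.span_diff mult_V \<pi>_mod W u v)
    also have "(c * var u - a) * var v - (c * var v - b) * var u = b * var u - a * var v"
      by (simp add: algebra_simps)
    finally have "b * var u - a * var v \<in> pspan M"
    proof (rule stabD)
      have "b * var u \<in> W" "a * var v \<in> W"
        unfolding a_def b_def by (intro mult_low \<pi>_low u v)+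
      then show "b * var u - a * var v \<in> W"
        unfolding W_def by (rule pvs.span_diff)
    qed
    then have "\<pi> (b * var u) = \<pi> (a * var v)" by (rule \<pi>_cong)
    moreover have "\<pi> a = a" "\<pi> b = b"
      unfolding a_def b_def by (rule \<pi>_idem[OF W(1)], rule \<pi>_idem[OF W(2)])
    ultimately show ?thesis by (simp add: X_def a_def b_def c_def)
  qed
  obtain Y :: "monomial \<Rightarrow> 'a mpol" where Y_zero: "Y 0 = \<pi> 1"
    and Y_step: "\<And>m v. v \<in> {1..n} \<Longrightarrow> Y (m + Poly_Mapping.single v 1) = X v (Y m)"
    by (rule commuting_monomial_action[of n X "\<pi> 1"]) (use X_comm in blast)+
  \<comment> \<open>The linear map that sends a polynomial to its action on \<open>\<pi> 1\<close>.
    Its values are prescribed on basis vectors, hence the inverse of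
    \<open>mpol_of_monom\<close>.\<close>
  obtain \<phi> :: "'a mpol \<Rightarrow> 'a mpol" where \<phi>: "Vector_Spaces.linear pscale pscale \<phi>"
    and \<phi>_base: "\<forall>b \<in> mpol_of_monom ` UNIV. \<phi> b = Y (the_inv mpol_of_monom b)"
    using pvs2.linear_independent_extend[OF independent_monoms[of UNIV],
        of "\<lambda>b. Y (the_inv mpol_of_monom b)"] by blast
  have \<phi>_monom: "\<phi> (mpol_of_monom m) = Y m" for m
    using \<phi>_base by (simp add: the_inv_f_f[OF inj_mpol_of_monom])
  have X_lin: "Vector_Spaces.linear pscale pscale (X v)" for v
    using Vector_Spaces.linear_compose[OF Vector_Spaces.linear_compose[OF \<pi> linear_mult_right] \<pi>]
    by (simp add: X_def[abs_def] o_def)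
  have \<phi>_var: "\<phi> (p * var v) = X v (\<phi> p)" if p: "p \<in> polys n" and v: "v \<in> {1..n}" for p v
  proof (rule pvs2.linear_eq_on[where f = "\<lambda>p. \<phi> (p * var v)" and g = "\<lambda>p. X v (\<phi> p)"])
    show "Vector_Spaces.linear pscale pscale (\<lambda>p. \<phi> (p * var v))"
      using Vector_Spaces.linear_compose[OF linear_mult_right \<phi>] by (simp add: o_def)
    show "Vector_Spaces.linear pscale pscale (\<lambda>p. X v (\<phi> p))"
      using Vector_Spaces.linear_compose[OF \<phi> X_lin] by (simp add: o_def)
    show "p \<in> pspan (mpol_of_monom ` monoms n)" using p by (simp add: polys_eq_span)
    show "\<phi> (b * var v) = X v (\<phi> b)" if "b \<in> mpol_of_monom ` monoms n" for b
      using that v Y_step by (auto simp: var_def mpol_of_monom_add[symmetric] \<phi>_monom)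
  qed

  \<comment> \<open>Up to degree \<open>d\<close>, acting variable by variable agrees with a single
    reduction.\<close>
  have Y_\<pi>: "Y m = \<pi> (mpol_of_monom m)" if "m \<in> monoms_le n d" for m
    using that
  proof (induction "mdeg m" arbitrary: m)
    case 0
    then show ?case by (simp add: mdeg_eq_0_iff Y_zero mpol_of_monom_def)
  next
    case (Suc k)
    then have "m \<in> monoms n" "m \<noteq> 0" by (auto simp: monoms_le_def)
    then obtain v m' where m': "v \<in> {1..n}" "m' \<in> monoms n"
        "m = m' + Poly_Mapping.single v 1" "mdeg m = Suc (mdeg m')"
      by (rule monom_decompose)
    have low: "mpol_of_monom m' \<in> low"
      using m' Suc.prems by (auto simp: low_def in_span_monoms_iff monoms_le_def)
    then have W: "mpol_of_monom m' \<in> W" using low_W by blast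
    have "Y m = X v (\<pi> (mpol_of_monom m'))"
      using m' Suc by (subst m'(3), subst Y_step) (auto simp: monoms_le_def)
    also have "\<dots> = \<pi> (\<pi> (mpol_of_monom m') * var v)"
      by (simp add: X_def \<pi>_idem[OF W])
    \<comment> \<open>Reducing before multiplying changes the product by an element of the span of
      \<open>M_plus n M\<close> inside \<open>W\<close>, which \<open>\<pi>\<close> does not
      see.\<close>
    also have "\<dots> = \<pi> (mpol_of_monom m' * var v)"
    proof (rule \<pi>_cong[symmetric], rule stabD)
      show "mpol_of_monom m' * var v - \<pi> (mpol_of_monom m') * var v \<in> pspan (M_plus n M)"
        using mult_V[OF \<pi>_mod[OF W] m'(1)] by (simp add: algebra_simps)
      show "mpol_of_monom m' * var v - \<pi> (mpol_of_monom m') * var v \<in> W"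
        using mult_low[OF low m'(1)] mult_low[OF \<pi>_low m'(1)]
        unfolding W_def by (rule pvs.span_diff)
    qed
    also have "mpol_of_monom m' * var v = mpol_of_monom m"
      by (simp add: m'(3) mpol_of_monom_add var_def)
    finally show ?case .
  qed
  have \<phi>_\<pi>: "\<phi> p = \<pi> p" if "p \<in> W" for p
    by (rule pvs2.linear_eq_on[OF \<phi> \<pi> that[unfolded W_def]]) (auto simp: \<phi>_monom Y_\<pi>)
  \<comment> \<open>By linearity \<open>c\<close> may be a monomial. Its variables are pulled out as
    operators \<open>X v\<close> until only \<open>\<phi> f = \<pi> f = 0\<close> remains.\<close>
  have \<phi>_gen: "\<phi> (c * f) = 0" if f: "f \<in> M" and c: "c \<in> polys n" for c f
  proof (rule pvs2.linear_eq_0_on_span[where f = "\<lambda>c. \<phi> (c * f)"])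
    show "Vector_Spaces.linear pscale pscale (\<lambda>c. \<phi> (c * f))"
      using Vector_Spaces.linear_compose[OF linear_mult_right \<phi>] by (simp add: o_def)
    show "c \<in> pspan (mpol_of_monom ` monoms n)" using c by (simp add: polys_eq_span)
    have "\<phi> (mpol_of_monom m * f) = 0" if "m \<in> monoms n" for m
      using that
    proof (induction "mdeg m" arbitrary: m)
      case 0
      have "f \<in> pspan M" using f by (rule pvs.span_base)
      then have "\<phi> f = 0" using \<phi>_\<pi> \<pi>_V V_W by auto
      then show ?case using 0 by (simp add: mdeg_eq_0_iff mpol_of_monom_def)
    next
      case (Suc k)
      from Suc have "m \<noteq> 0" by auto
      with Suc.prems obtain v m' where m': "v \<in> {1..n}" "m' \<in> monoms n"
          "m = m' + Poly_Mapping.single v 1" "mdeg m = Suc (mdeg m')"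
        by (rule monom_decompose)
      have "mpol_of_monom m * f = (mpol_of_monom m' * f) * var v"
        by (simp add: m'(3) mpol_of_monom_add var_def ac_simps)
      also have "\<phi> \<dots> = X v (\<phi> (mpol_of_monom m' * f))"
        using f sub m' by (intro \<phi>_var polys_mult) auto
      also have "\<dots> = 0"
        using Suc m' pvs2.linear_0[OF X_lin] by simp
      finally show ?case .
    qed
    then show "\<phi> (b * f) = 0" if "b \<in> mpol_of_monom ` monoms n" for b
      using that by auto
  qed
  obtain F c where Fc: "p = (\<Sum>f\<in>F. c f * f)" "F \<subseteq> M" "\<forall>f\<in>F. c f \<in> polys n"
    using p by (auto simp: ideal_gen_def)
  have "p \<in> polys n"
    unfolding Fc(1) using Fc sub by (intro pvs.subspace_sum[OF subspace_polys] polys_mult) auto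
  then have "p \<in> W"
    using deg by (auto simp: W_def in_span_monoms_iff polys_def monoms_le_def pdeg_le_iff)
  moreover have "\<phi> p = 0"
    unfolding Fc(1) using Fc \<phi>_gen by (subst pvs2.linear_sum[OF \<phi>]) (auto intro!: sum.neutral)
  \<comment> \<open>Now \<open>\<pi> p = \<phi> p = 0\<close>, so \<open>p\<close> equals
    \<open>p - \<pi> p\<close>.\<close>
  ultimately show ?thesis using \<phi>_\<pi> \<pi>_mod by fastforce
qed


subsection \<open>Graded pieces\<close>

lemma subspace_pdeg_le:
  assumes "pvs.subspace V"
  shows "pvs.subspace {p \<in> V. pdeg p \<le> i}"
proof -
  have "{p :: 'a mpol. pdeg p \<le> i} = pspan (mpol_of_monom ` {m. mdeg m \<le> i})"
    by (auto simp: in_span_monoms_iff pdeg_le_iff)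
  then have "pvs.subspace {p :: 'a mpol. pdeg p \<le> i}" by simp
  from pvs.subspace_inter[OF assms this] show ?thesis
    by (simp add: Int_def)
qed

lemma subspace_graded_piece:
  "pvs.subspace V \<Longrightarrow> pvs.subspace (graded_piece V i)"
  unfolding graded_piece_def
  by (intro pvs2.linear_subspace_image[OF linear_hom_comp] subspace_pdeg_le)

lemma graded_piece_subset:
  "V \<subseteq> polys n \<Longrightarrow> graded_piece V i \<subseteq> pspan (mpol_of_monom ` monoms_eq n i)"
  by (fastforce simp: graded_piece_def in_span_monoms_iff keys_hom_comp monoms_eq_def polys_def)

section \<open>The ideal as a subspace closed under multiplication\<close>

text \<open>Padding with zero coefficients gives all elements the same index set \<open>M\<close>,
  so that sums can be formed coefficientwise.\<close>

lemma ideal_gen_finite: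
  assumes "finite M"
  shows "ideal_gen n M = {\<Sum>f\<in>M. c f * f | c. \<forall>f\<in>M. c f \<in> polys n}"
proof (intro equalityI subsetI)
  fix p assume "p \<in> ideal_gen n M"
  then obtain F c where F: "p = (\<Sum>f\<in>F. c f * f)" "F \<subseteq> M" "\<forall>f\<in>F. c f \<in> polys n"
    by (auto simp: ideal_gen_def)
  define c' where "c' f = (if f \<in> F then c f else 0)" for f
  have "p = (\<Sum>f\<in>M. c' f * f)"
    unfolding F(1) using F(2) assms
    by (intro sum.mono_neutral_cong_left) (auto simp: c'_def)
  moreover have "\<forall>f\<in>M. c' f \<in> polys n"
    using F(3) by (auto simp: c'_def polys_def)
  ultimately show "p \<in> {\<Sum>f\<in>M. c f * f | c. \<forall>f\<in>M. c f \<in> polys n}" by blast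
qed (use assms in \<open>auto simp: ideal_gen_def\<close>)

lemma subspace_ideal_gen:
  assumes "finite M"
  shows "pvs.subspace (ideal_gen n M)"
  unfolding ideal_gen_finite[OF assms]
proof (rule pvs.subspaceI)
  show "0 \<in> {\<Sum>f\<in>M. c f * f | c. \<forall>f\<in>M. c f \<in> polys n}"
    by (intro CollectI exI[of _ "\<lambda>_. 0"]) (simp add: polys_def)
next
  fix p q assume "p \<in> {\<Sum>f\<in>M. c f * f | c. \<forall>f\<in>M. c f \<in> polys n}"
    "q \<in> {\<Sum>f\<in>M. c f * f | c. \<forall>f\<in>M. c f \<in> polys n}"
  then obtain c e where "p = (\<Sum>f\<in>M. c f * f)" "\<forall>f\<in>M. c f \<in> polys n"
    "q = (\<Sum>f\<in>M. e f * f)" "\<forall>f\<in>M. e f \<in> polys n" by blast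
  then show "p + q \<in> {\<Sum>f\<in>M. c f * f | c. \<forall>f\<in>M. c f \<in> polys n}"
    by (intro CollectI exI[of _ "\<lambda>f. c f + e f"])
      (auto simp: sum.distrib algebra_simps intro: pvs.subspace_add[OF subspace_polys])
next
  fix k p assume "p \<in> {\<Sum>f\<in>M. c f * f | c. \<forall>f\<in>M. c f \<in> polys n}"
  then obtain c where "p = (\<Sum>f\<in>M. c f * f)" "\<forall>f\<in>M. c f \<in> polys n" by blast
  then show "pscale k p \<in> {\<Sum>f\<in>M. c f * f | c. \<forall>f\<in>M. c f \<in> polys n}"
    by (intro CollectI exI[of _ "\<lambda>f. pscale k (c f)"])
      (auto simp: pscale_eq_mult sum_distrib_left mult.assoc
        intro: pvs.subspace_scale[OF subspace_polys, unfolded pscale_eq_mult])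
qed

lemma ideal_gen_mult:
  assumes "finite M" "p \<in> ideal_gen n M" "q \<in> polys n"
  shows "p * q \<in> ideal_gen n M"
proof -
  from assms(1,2) obtain c where c: "p = (\<Sum>f\<in>M. c f * f)" "\<forall>f\<in>M. c f \<in> polys n"
    by (auto simp: ideal_gen_finite)
  have "p * q = (\<Sum>f\<in>M. (c f * q) * f)"
    by (simp add: c(1) sum_distrib_left ac_simps)
  moreover have "\<forall>f\<in>M. c f * q \<in> polys n"
    using c(2) assms(3) by (auto intro: polys_mult)
  ultimately show ?thesis
    unfolding ideal_gen_finite[OF assms(1)] by (intro CollectI exI[of _ "\<lambda>f. c f * q"]) simp
qed

lemma span_subset_ideal_gen:
  assumes "finite M"
  shows "pspan M \<subseteq> ideal_gen n M"
proof (rule pvs.span_minimal[OF _ subspace_ideal_gen[OF assms]])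
  show "M \<subseteq> ideal_gen n M"
  proof
    fix f assume "f \<in> M"
    moreover have "(1 :: 'a mpol) \<in> polys n"
      using mpol_of_monom_in_polys[of 0 n] by (simp add: mpol_of_monom_def)
    ultimately show "f \<in> ideal_gen n M"
      unfolding ideal_gen_def
      by (intro CollectI exI[of _ "{f}"] exI[of _ "\<lambda>_. 1"]) auto
  qed
qed

lemma ideal_gen_subset_polys:
  "M \<subseteq> polys n \<Longrightarrow> ideal_gen n M \<subseteq> polys n"
  by (auto simp: ideal_gen_def intro!: pvs.subspace_sum[OF subspace_polys] polys_mult)

section \<open>Graded pieces of the ideal and leading forms of its generators\<close>

lemma graded_piece_ideal_gen_le:
  fixes M :: "'a::field mpol set"
  assumes "finite M" "M \<subseteq> polys n" "stabilized n (monoms_le n d) M"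
    and "mpol_of_monom ` monoms_eq n d \<subseteq> graded_piece (pspan M) d" and "i \<le> d"
  shows "graded_piece (ideal_gen n M) i = graded_piece (pspan M) i"
  using stabilized_ideal_le[OF assms(2-4)] span_subset_ideal_gen[OF assms(1), of n] assms(5)
  unfolding graded_piece_def by (intro image_cong) auto

text \<open>A monomial of degree at least \<open>d\<close> is a multiple \<open>m' + t\<close> of
  one of degree \<open>d\<close>. An element of the span with top component \<open>m'\<close>, times
  the monomial \<open>t\<close>, has it as its top component.\<close>

lemma graded_piece_ideal_gen_ge:
  fixes M :: "'a::field mpol set"
  assumes M: "finite M" "M \<subseteq> polys n"
    and top: "mpol_of_monom ` monoms_eq n d \<subseteq> graded_piece (pspan M) d" and i: "d \<le> i"
  shows "graded_piece (ideal_gen n M) i = pspan (mpol_of_monom ` monoms_eq n i)"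
proof
  show "graded_piece (ideal_gen n M) i \<subseteq> pspan (mpol_of_monom ` monoms_eq n i)"
    by (rule graded_piece_subset[OF ideal_gen_subset_polys[OF M(2)]])
  show "pspan (mpol_of_monom ` monoms_eq n i) \<subseteq> graded_piece (ideal_gen n M) i"
  proof (rule pvs.span_minimal[OF _ subspace_graded_piece[OF subspace_ideal_gen[OF M(1)]]], clarify)
    fix m assume "m \<in> monoms_eq n i"
    then have m: "m \<in> monoms n" "mdeg m = i" by (auto simp: monoms_eq_def)
    with i obtain m' t where mt: "m' \<in> monoms_eq n d" "t \<in> monoms n" "m = m' + t"
      using monom_split_degree by metis
    then obtain p where p: "p \<in> pspan M" "pdeg p \<le> d" "hom_comp d p = mpol_of_monom m'"
      using top by (force simp: graded_piece_def)
    define q where "q = p - mpol_of_monom m'"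
    have q: "mdeg k < d" if "k \<in> Poly_Mapping.keys q" for k
    proof -
      have "k \<in> Poly_Mapping.keys p" "mdeg k \<noteq> d"
        using that
        by (auto simp: q_def p(3)[symmetric] in_keys_iff lookup_minus lookup_hom_comp split: if_splits)
      then show ?thesis using p(2) by (auto simp: pdeg_le_iff le_neq_implies_less)
    qed
    have i_eq: "i = d + mdeg t"
      using m(2) mt by (auto simp: mdeg_add monoms_eq_def)
    have qt: "mdeg k < i" if k: "k \<in> Poly_Mapping.keys (q * mpol_of_monom t)" for k
      using subsetD[OF keys_mult k] q by (auto simp: mdeg_add i_eq)
    have pt: "p * mpol_of_monom t = mpol_of_monom m + q * mpol_of_monom t"
      by (simp add: q_def mt(3) mpol_of_monom_add algebra_simps)
    have "pdeg (p * mpol_of_monom t) \<le> i"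
      unfolding pdeg_le_iff pt using qt m(2)
      by (auto dest!: subsetD[OF Poly_Mapping.keys_add] intro: less_imp_le)
    moreover have "p * mpol_of_monom t \<in> ideal_gen n M"
      using p(1) span_subset_ideal_gen[OF M(1), of n] mt(2) by (intro ideal_gen_mult M(1)) auto
    moreover have "hom_comp i (p * mpol_of_monom t) = mpol_of_monom m"
    proof (rule poly_mapping_eqI)
      fix k
      have "Poly_Mapping.lookup (q * mpol_of_monom t) k = 0" if "mdeg k = i"
        using qt[of k] that by (auto simp: in_keys_iff)
      then show "Poly_Mapping.lookup (hom_comp i (p * mpol_of_monom t)) k =
          Poly_Mapping.lookup (mpol_of_monom m) k"
        using m(2) unfolding lookup_hom_comp pt lookup_add
        by (auto simp: mpol_of_monom_def lookup_single when_def)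
    qed
    ultimately show "mpol_of_monom m \<in> graded_piece (ideal_gen n M) i"
      unfolding graded_piece_def by (metis (mono_tags, lifting) image_eqI mem_Collect_eq)
  qed
qed

text \<open>Canonical form excludes cancellation of leading terms: in a combination of
  \<open>M\<close>, the coefficient at \<open>lt q\<close> comes from \<open>q\<close> alone. So an
  element of degree at most \<open>i\<close> involves no generator of larger degree, and generators
  of smaller degree do not reach degree \<open>i\<close>.\<close>

lemma graded_piece_canonical_form:
  fixes M :: "'a::field mpol set"
  assumes M: "finite M" and canonical: "canonical_form M"
  shows "graded_piece (pspan M) i = pspan (leading_form ` {p \<in> M. pdeg p = i})"
proof
  show "pspan (leading_form ` {p \<in> M. pdeg p = i}) \<subseteq> graded_piece (pspan M) i"
  proof (rule pvs.span_minimal)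
    show "leading_form ` {p \<in> M. pdeg p = i} \<subseteq> graded_piece (pspan M) i"
      by (auto simp: graded_piece_def leading_form_def pvs.span_base)
  qed (simp add: subspace_graded_piece)
  from canonical obtain lt :: "'a mpol \<Rightarrow> monomial" where
    lt: "\<And>p. p \<in> M \<Longrightarrow> lt p \<in> Poly_Mapping.keys p"
    "\<And>p m. p \<in> M \<Longrightarrow> m \<in> Poly_Mapping.keys p \<Longrightarrow> mdeg m \<le> mdeg (lt p)"
    "\<And>p q. p \<in> M \<Longrightarrow> q \<in> M \<Longrightarrow> q \<noteq> p \<Longrightarrow> lt p \<notin> Poly_Mapping.keys q"
    unfolding canonical_form_def by metis
  show "graded_piece (pspan M) i \<subseteq> pspan (leading_form ` {p \<in> M. pdeg p = i})"
  proof
    fix h assume "h \<in> graded_piece (pspan M) i"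
    then obtain p where p: "p \<in> pspan M" "pdeg p \<le> i" "h = hom_comp i p"
      by (auto simp: graded_piece_def)
    from p(1) obtain c where c: "p = (\<Sum>q\<in>M. pscale (c q) q)"
      by (auto simp: pvs.span_finite[OF M])
    have c_zero: "c q = 0" if q: "q \<in> M" "i < pdeg q" for q
    proof -
      have "i < mdeg (lt q)"
        using lt(2)[OF q(1)] q(2) pdeg_le_iff[of q "mdeg (lt q)"] by force
      then have "0 = Poly_Mapping.lookup p (lt q)"
        using p(2) unfolding pdeg_le_iff by (metis in_keys_iff not_le)
      also have "\<dots> = (\<Sum>r\<in>M. c r * Poly_Mapping.lookup r (lt q))"
        by (simp add: c lookup_sum lookup_pscale)
      also have "\<dots> = (\<Sum>r\<in>{q}. c r * Poly_Mapping.lookup r (lt q))"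
        using M q(1) lt(3)[OF q(1)] by (intro sum.mono_neutral_right) (auto simp: in_keys_iff)
      finally show "c q = 0" using lt(1)[OF q(1)] by (simp add: in_keys_iff)
    qed
    have "h = (\<Sum>q\<in>M. pscale (c q) (hom_comp i q))"
      unfolding p(3) c
      by (simp add: pvs2.linear_sum[OF linear_hom_comp] pvs2.linear_scale[OF linear_hom_comp])
    also have "\<dots> \<in> pspan (leading_form ` {p \<in> M. pdeg p = i})"
    proof (rule pvs.span_sum)
      fix q assume q: "q \<in> M"
      consider "pdeg q < i" | "pdeg q = i" | "i < pdeg q" by linarith
      then show "pscale (c q) (hom_comp i q) \<in> pspan (leading_form ` {p \<in> M. pdeg p = i})"
      proof cases
        case 2
        then have "hom_comp i q \<in> leading_form ` {p \<in> M. pdeg p = i}"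
          using q by (auto simp: leading_form_def)
        then show ?thesis by (intro pvs.span_scale pvs.span_base)
      qed (simp_all add: hom_comp_eq_0 c_zero q pvs.span_zero)
    qed
    finally show "h \<in> pspan (leading_form ` {p \<in> M. pdeg p = i})" .
  qed
qed

subsection \<open>Dimension and rank\<close>

text \<open>An isomorphism preserves dimension, and a subspace of full finite dimension is
  everything. This turns the abstract isomorphism in degree \<open>d\<close> into an
  equality.\<close>

lemma linear_iso_subspace_eq:
  fixes G :: "'a::field mpol set"
  assumes iso: "linear_iso G (pspan A)" and G: "pvs.subspace G" "G \<subseteq> pspan A"
    and A: "finite A" "pvs.independent A"
  shows "G = pspan A"
proof
  from iso obtain f where f: "bij_betw f G (pspan A)"
    and f_add: "\<And>x y. x \<in> G \<Longrightarrow> y \<in> G \<Longrightarrow> f (x + y) = f x + f y"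
    and f_scale: "\<And>c x. x \<in> G \<Longrightarrow> f (pscale c x) = pscale c (f x)"
    unfolding linear_iso_def by blast
  obtain B where B: "B \<subseteq> G" "pvs.independent B" "G \<subseteq> pspan B"
    by (rule pvs.maximal_independent_subset)
  have BG: "pspan B = G"
    using B G(1) by (simp add: pvs.span_minimal subset_antisym)
  \<comment> \<open>The map \<open>f\<close> is known to be linear on \<open>G\<close> only;
    \<open>h\<close> is a linear map on all polynomials that agrees with it there.\<close>
  obtain h where h: "Vector_Spaces.linear pscale pscale h" "\<forall>b\<in>B. h b = f b"
    using pvs2.linear_independent_extend[OF B(2), of f] by blast
  have "pvs.subspace {x \<in> G. h x = f x}"
    unfolding pvs.subspace_def
    using f_add f_scale[of 0 0] f_scale pvs.subspace_0[OF G(1)] pvs.subspace_add[OF G(1)]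
      pvs.subspace_scale[OF G(1)] pvs2.linear_0[OF h(1)]
    by (auto simp: pvs2.linear_add[OF h(1)] pvs2.linear_scale[OF h(1)])
  then have "pspan B \<subseteq> {x \<in> G. h x = f x}"
    using h(2) B(1) by (intro pvs.span_minimal) auto
  then have "h x = f x" if "x \<in> G" for x using that BG by blast
  then have "pspan A = h ` pspan B"
    using f by (simp add: bij_betw_def BG)
  also have "\<dots> = pspan (h ` B)"
    by (rule pvs2.linear_span_image[OF h(1), symmetric])
  finally have span_A: "pspan A = pspan (h ` B)" .
  have B_fin: "finite B" "card B \<le> card A"
    using pvs.independent_span_bound[OF A(1) B(2)] B(1) G(2) by auto
  have "card A \<le> card (h ` B)"
    using pvs.independent_span_bound[of "h ` B" A] A(2) B_fin span_A pvs.span_superset by blast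
  also have "\<dots> \<le> card B" by (rule card_image_le[OF B_fin(1)])
  finally have card: "card A \<le> card B" .
  show "pspan A \<subseteq> G"
  proof (rule pvs.span_minimal[OF _ G(1)], rule subsetI, rule ccontr)
    fix a assume a: "a \<in> A" "a \<notin> G"
    then have "pvs.independent (insert a B)" "insert a B \<subseteq> pspan A" "a \<notin> B"
      using B G(2) BG pvs.independent_insertI pvs.span_base by blast+
    with pvs.independent_span_bound[OF A(1), of "insert a B"] B_fin(1) card show False by auto
  qed
qed (rule G(2))

text \<open>Restricting coefficient vectors to \<open>U\<close> is reduction modulo the monomials of
  \<open>T - U\<close>, so the rank counts the dimensions that \<open>S\<close> adds to
  them.\<close>

lemma dim_span_Un_monoms:
  fixes S :: "'a::field mpol set"
  assumes fin: "finite T" "finite S" and supp: "\<And>p. p \<in> S \<Longrightarrow> Poly_Mapping.keys p \<subseteq> T"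
    and U: "U \<subseteq> T"
  shows "pdim (pspan (mpol_of_monom ` (T - U) \<union> pspan S)) =
    card (T - U) + mat_rank S U Poly_Mapping.lookup"
proof -
  define A :: "'a mpol set" where "A = mpol_of_monom ` (T - U)"
  have A: "pvs.independent A" "finite A" "card A = card (T - U)"
    unfolding A_def using fin(1) independent_monoms
    by (auto intro!: card_image inj_on_subset[OF inj_mpol_of_monom])
  \<comment> \<open>The monomials outside \<open>U\<close> are completed to a basis by elements of
    \<open>S\<close>; these elements form \<open>C\<close>, and the rank will be their
    number.\<close>
  obtain B where B: "A \<subseteq> B" "B \<subseteq> A \<union> S" "pvs.independent B" "A \<union> S \<subseteq> pspan B"
    by (rule pvs.maximal_independent_subset_extend[of A "A \<union> S"]) (use A in auto)
  define C where "C = B - A"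
  have finB: "finite B" using B(2) A(2) fin(2) finite_subset by blast
  have "pspan B = pspan (A \<union> pspan S)"
  proof (rule subset_antisym)
    show "pspan B \<subseteq> pspan (A \<union> pspan S)"
      using B(2) pvs.span_superset[of S] by (intro pvs.span_mono) blast
    have "pspan S \<subseteq> pspan B" using B(4) by (intro pvs.span_minimal) auto
    then show "pspan (A \<union> pspan S) \<subseteq> pspan B"
      using B(4) by (intro pvs.span_minimal) auto
  qed
  then have dim: "pdim (pspan (A \<union> pspan S)) = card A + card C"
    using B(1,3) finB A(2) card_mono[OF finB B(1)]
    by (metis C_def card_Diff_subset le_add_diff_inverse pvs.dim_span_eq_card_independent)

  define f :: "'a mpol \<Rightarrow> monomial \<Rightarrow> 'a"
    where "f p = (\<lambda>c. if c \<in> U then Poly_Mapping.lookup p c else 0)" for p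
  have f: "Vector_Spaces.linear pscale (\<lambda>c f x. c * f x) f"
    by unfold_locales (auto simp: f_def fun_eq_iff lookup_add lookup_pscale algebra_simps)
  have f_A: "f a = 0" if "a \<in> A" for a
    using that by (auto simp: A_def f_def fun_eq_iff mpol_of_monom_def lookup_single when_def)
  obtain g where g: "Vector_Spaces.linear pscale pscale g" "\<forall>b\<in>B. g b = (if b \<in> A then 0 else b)"
    using pvs2.linear_independent_extend[OF B(3), of "\<lambda>b. if b \<in> A then 0 else b"] by blast
  \<comment> \<open>An element of the span of \<open>C\<close> that vanishes on \<open>U\<close>
    lies in the span of \<open>A\<close>. The projection \<open>g\<close>, which kills
    \<open>A\<close> and fixes \<open>C\<close>, then shows that it is 0.\<close>
  have inj: "inj_on f (pspan C)"
    unfolding pfvs.linear_inj_on_iff_eq_0[OF f pvs.subspace_span]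
  proof (intro ballI impI)
    fix x assume x: "x \<in> pspan C" "f x = 0"
    have "C \<subseteq> S" using B(2) by (auto simp: C_def)
    then have "pspan C \<subseteq> pspan (mpol_of_monom ` T)"
      using supp by (intro pvs.span_minimal) (auto simp: in_span_monoms_iff)
    then have "Poly_Mapping.keys x \<subseteq> T" using x(1) in_span_monoms_iff by blast
    moreover have "Poly_Mapping.lookup x m = 0" if "m \<in> U" for m
      using that fun_cong[OF x(2), of m] by (simp add: f_def)
    ultimately have "x \<in> pspan A"
      by (auto simp: A_def in_span_monoms_iff in_keys_iff)
    then have "g x = 0"
      by (rule pvs2.linear_eq_0_on_span[OF g(1), rotated]) (use g(2) B(1) in auto)
    moreover have "g x = x"
      by (rule pvs2.linear_eq_on[OF g(1) pvs.linear_ident x(1)]) (use g(2) C_def in auto)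
    ultimately show "x = 0" by simp
  qed
  have "fvs.span (f ` C) = fvs.span (f ` S)"
  proof (rule subset_antisym)
    show "fvs.span (f ` C) \<subseteq> fvs.span (f ` S)"
      using B(2) by (intro fvs.span_mono) (auto simp: C_def)
    have "f ` S \<subseteq> f ` pspan B" using B(4) by blast
    also have "\<dots> = fvs.span (f ` B)" by (rule pfvs.linear_span_image[OF f, symmetric])
    also have "\<dots> \<subseteq> fvs.span (f ` C)"
    proof (rule fvs.span_minimal[OF _ fvs.subspace_span], clarify)
      fix b assume "b \<in> B"
      then show "f b \<in> fvs.span (f ` C)"
        using f_A by (cases "b \<in> A") (auto simp: C_def fvs.span_zero intro: fvs.span_base)
    qed
    finally show "fvs.span (f ` S) \<subseteq> fvs.span (f ` C)"
      by (intro fvs.span_minimal fvs.subspace_span)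
  qed
  moreover have "fvs.independent (f ` C)"
    using B(3) pvs.independent_mono[of B C] inj
    by (intro pfvs.linear_independent_injective_image[OF f]) (auto simp: C_def)
  ultimately have "fvs.dim (f ` S) = card (f ` C)"
    by (intro fvs.dim_eq_card)
  also have "\<dots> = card C"
    using inj_on_subset[OF inj pvs.span_superset] by (rule card_image)
  finally have "mat_rank S U Poly_Mapping.lookup = card C"
    by (simp add: mat_rank_def f_def[abs_def])
  then show ?thesis using dim A(3) by (simp add: A_def)
qed

text \<open>
  Constraint (3) of the polytope for \<open>U\<close> is the rank constraint for the complement of \<open>U\<close>:
  the values of \<open>z\<close> on the two sets have a fixed sum, and the rank of the columns outside
  \<open>U\<close> is the dimension of the space modulo the monomials in \<open>U\<close>.
\<close>

lemma rank_constraints_complement: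
  fixes S :: "'a::field mpol set" and z :: "monomial \<Rightarrow> real"
  assumes fin: "finite T" "finite S" and supp: "\<And>p. p \<in> S \<Longrightarrow> Poly_Mapping.keys p \<subseteq> T"
    and sum: "(\<Sum>m\<in>T. z m) = real (card T) - real (pdim (pspan S))"
  shows "(\<forall>U\<subseteq>T. real (card U) = real (card T) - real (pdim (pspan S)) \<longrightarrow>
      (\<Sum>m\<in>U. z m) \<le> real (pdim (pspan (mpol_of_monom ` U \<union> pspan S))) - real (pdim (pspan S)))
    \<longleftrightarrow> (\<forall>U\<subseteq>T. card U = pdim (pspan S) \<longrightarrow>
      (\<Sum>m\<in>U. z m) \<ge> real (card U) - real (mat_rank S U Poly_Mapping.lookup))"
    (is "(\<forall>U\<subseteq>T. ?P U) \<longleftrightarrow> (\<forall>U\<subseteq>T. ?Q U)")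
proof -
  have PQ: "?P (T - U) \<longleftrightarrow> ?Q U" if U: "U \<subseteq> T" for U
  proof -
    have card: "card (T - U) = card T - card U" "card U \<le> card T"
      using U fin(1) by (auto simp: card_Diff_subset finite_subset card_mono)
    have "(\<Sum>m\<in>T - U. z m) = (\<Sum>m\<in>T. z m) - (\<Sum>m\<in>U. z m)"
      by (rule sum_diff[OF fin(1) U])
    moreover have "pdim (pspan (mpol_of_monom ` (T - U) \<union> pspan S)) =
        card (T - U) + mat_rank S U Poly_Mapping.lookup"
      by (rule dim_span_Un_monoms[OF fin supp U])
    ultimately show ?thesis
      using card sum by (simp add: of_nat_diff) linarith
  qed
  show ?thesis
  proof (intro iffI allI impI)
    fix U assume "\<forall>U\<subseteq>T. ?P U" "U \<subseteq> T" "card U = pdim (pspan S)"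
    then show "(\<Sum>m\<in>U. z m) \<ge> real (card U) - real (mat_rank S U Poly_Mapping.lookup)"
      using PQ[of U] by blast
  next
    fix U assume *: "\<forall>U\<subseteq>T. ?Q U" "U \<subseteq> T"
      "real (card U) = real (card T) - real (pdim (pspan S))"
    have "T - (T - U) = U" using *(2) by blast
    then show "(\<Sum>m\<in>U. z m) \<le>
        real (pdim (pspan (mpol_of_monom ` U \<union> pspan S))) - real (pdim (pspan S))"
      using PQ[of "T - U"] * by auto
  qed
qed

text \<open>For empty \<open>U\<close> both sides are 0, and for \<open>U = T\<close> the bound is
  the equality of that degree. In degree 0 and from degree \<open>d\<close> on, no other
  \<open>U\<close> has to be considered.\<close>

lemma dim_constraint_trivial:
  fixes G :: "'a::field mpol set" and z :: "monomial \<Rightarrow> real"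
  assumes "G \<subseteq> pspan (mpol_of_monom ` T)"
    and "(\<Sum>m\<in>T. z m) = real (card T) - real (pdim G)" and "U = {} \<or> U = T"
  shows "(\<Sum>m\<in>U. z m) \<le> real (pdim (pspan (mpol_of_monom ` U \<union> G))) - real (pdim G)"
  using assms(3)
proof
  assume "U = T"
  moreover have "pspan (mpol_of_monom ` T \<union> G) = pspan (mpol_of_monom ` T)"
  proof (rule subset_antisym)
    show "pspan (mpol_of_monom ` T \<union> G) \<subseteq> pspan (mpol_of_monom ` T)"
      using assms(1) pvs.span_superset[of "mpol_of_monom ` T"]
      by (intro pvs.span_minimal pvs.subspace_span Un_least)
  qed (rule pvs.span_mono[OF Un_upper1])
  ultimately show ?thesis
    using assms(2) by (simp only: dim_span_monoms)
qed simp

subsection \<open>The polytope\<close>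

text \<open>The equalities include both end degrees: in degree \<open>d\<close> the sum is 0, so
  these nonnegative coordinates vanish, and in degree 0 the coordinate of the constant monomial is
  fixed. The rank constraints in these two degrees follow.\<close>

theorem lemma3p6:
  fixes n d :: nat
    and L :: "monomial set"
    and M :: "'a::field mpol set"
    and Ms :: "nat \<Rightarrow> 'a mpol set"
  assumes "L = monoms_le n d"
    and "M = (\<Union>i. Ms i)"
    and "\<And>i p. p \<in> Ms i \<Longrightarrow> p \<noteq> 0 \<and> pdeg p = i"
    and "M \<subseteq> polys n"
    and "finite M"
    and "zero_dimensional n (ideal_gen n M)"
    and "stabilized n L M"
    and "canonical_form M"
    and "linear_iso (graded_piece (pspan M) d) (pspan (mpol_of_monom ` monoms_eq n d))"
  shows "order_ideal_polytope_on n M L = {z \<in> L \<rightarrow>\<^sub>E {0..1}.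
      (\<forall>m1 \<in> L. \<forall>m2 \<in> L. mdvd m1 m2 \<longrightarrow> z m1 \<ge> z m2)
    \<and> (\<forall>i \<in> {0..d}. (\<Sum>m \<in> degree_part L i. z m) =
          real (pdim (pspan (mpol_of_monom ` degree_part L i) :: 'a mpol set))
          - real (pdim (pspan (leading_form ` Ms i))))
    \<and> (\<forall>i \<in> {1..d - 1}. \<forall>U \<subseteq> degree_part L i.
          card U = pdim (pspan (leading_form ` Ms i)) \<longrightarrow>
          (\<Sum>m\<in>U. z m) \<ge> real (card U)
            - real (mat_rank (leading_form ` Ms i) U Poly_Mapping.lookup))}"
proof -
  have L: "L = monoms_le n d" by fact
  have M: "finite M" "M \<subseteq> polys n" by fact+
  have Ms: "Ms i = {p \<in> M. pdeg p = i}" for i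
    using assms(2,3) by auto
  define G where "G i = graded_piece (ideal_gen n M) i" for i
  define T where "T i = monoms_eq n i" for i
  have part: "degree_part L i = T i" if "i \<le> d" for i
    using that by (auto simp: degree_part_def L T_def monoms_le_def monoms_eq_def)
  have TL: "T i \<subseteq> L" if "i \<le> d" for i
    using that by (auto simp: L T_def monoms_le_def monoms_eq_def)
  have LM: "L \<subseteq> monoms n" by (auto simp: L monoms_le_def)
  have finT: "finite (T i)" for i by (simp add: T_def finite_monoms_eq)
  have "pspan M \<subseteq> polys n"
    using M(2) by (rule pvs.span_minimal[OF _ subspace_polys])
  then have "graded_piece (pspan M) d = pspan (mpol_of_monom ` monoms_eq n d)"
    using assms(9) by (intro linear_iso_subspace_eq subspace_graded_piece graded_piece_subset
        finite_imageI finite_monoms_eq independent_monoms) auto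
  then have top: "mpol_of_monom ` monoms_eq n d \<subseteq> graded_piece (pspan M) d"
    using pvs.span_superset by blast
  have G_le: "G i = pspan (leading_form ` Ms i)" if "i \<le> d" for i
    using graded_piece_ideal_gen_le[OF M _ top that] assms(7,8) graded_piece_canonical_form[OF M(1)]
    by (simp add: G_def L Ms)
  have G_ge: "G i = pspan (mpol_of_monom ` T i)" if "d \<le> i" for i
    using graded_piece_ideal_gen_ge[OF M top that] by (simp add: G_def T_def)
  have dim_ge: "pdim (G i) = card (T i)" if "d \<le> i" for i
    by (simp only: G_ge[OF that] dim_span_monoms)
  have G_sub: "G i \<subseteq> pspan (mpol_of_monom ` T i)" for i
    unfolding G_def T_def by (rule graded_piece_subset[OF ideal_gen_subset_polys[OF M(2)]])
  \<comment> \<open>Constraint (3) in a single degree; it depends only on the values of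
    \<open>z\<close> on \<open>T i\<close>.\<close>
  define bounded :: "(monomial \<Rightarrow> real) \<Rightarrow> nat \<Rightarrow> bool" where
    "bounded z i \<longleftrightarrow> (\<forall>U\<subseteq>T i. real (card U) = real (card (T i)) - real (pdim (G i)) \<longrightarrow>
      (\<Sum>m\<in>U. z m) \<le> real (pdim (pspan (mpol_of_monom ` U \<union> G i))) - real (pdim (G i)))" for z i
  have bounded_cong: "bounded z i = bounded z' i" if "\<And>m. m \<in> T i \<Longrightarrow> z m = z' m" for z z' i
  proof -
    have "sum z U = sum z' U" if "U \<subseteq> T i" for U
      using that \<open>\<And>m. m \<in> T i \<Longrightarrow> z m = z' m\<close> by (intro sum.cong) auto
    then show ?thesis unfolding bounded_def by auto
  qed
  have polytope: "order_ideal_polytope n (ideal_gen n M) = {z \<in> monoms n \<rightarrow>\<^sub>E {0..1}.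
      (\<forall>m1 \<in> monoms n. \<forall>m2 \<in> monoms n. mdvd m1 m2 \<longrightarrow> z m1 \<ge> z m2)
    \<and> (\<forall>i. (\<Sum>m\<in>T i. z m) = real (card (T i)) - real (pdim (G i))) \<and> (\<forall>i. bounded z i)}"
    unfolding order_ideal_polytope_def bounded_def dim_span_monoms G_def T_def by simp
  have bounded_rank: "bounded z i \<longleftrightarrow> (\<forall>U\<subseteq>T i. card U = pdim (G i) \<longrightarrow>
      (\<Sum>m\<in>U. z m) \<ge> real (card U) - real (mat_rank (leading_form ` Ms i) U Poly_Mapping.lookup))"
    if "i \<le> d" "(\<Sum>m\<in>T i. z m) = real (card (T i)) - real (pdim (G i))" for z i
    unfolding bounded_def G_le[OF that(1)]
  proof (rule rank_constraints_complement[OF finT])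
    show "finite (leading_form ` Ms i)" using M(1) by (simp add: Ms)
    show "Poly_Mapping.keys p \<subseteq> T i" if "p \<in> leading_form ` Ms i" for p
      using that M(2)
      by (fastforce simp: Ms T_def leading_form_def keys_hom_comp polys_def monoms_eq_def)
  qed (use that G_le in simp)
  \<comment> \<open>There is only one monomial of degree 0. From degree \<open>d\<close> on,
    \<open>G i\<close> is everything, so the prescribed size of \<open>U\<close> is 0.\<close>
  have bounded_outer: "bounded z i"
    if "i = 0 \<or> d \<le> i" "(\<Sum>m\<in>T i. z m) = real (card (T i)) - real (pdim (G i))" for z i
    unfolding bounded_def
  proof (intro allI impI)
    fix U assume U: "U \<subseteq> T i" "real (card U) = real (card (T i)) - real (pdim (G i))"
    have "U = {} \<or> U = T i"
      using that(1)
    proof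
      assume "i = 0"
      then have "T i \<subseteq> {0}" by (auto simp: T_def monoms_eq_def mdeg_eq_0_iff)
      then show ?thesis using U(1) by blast
    next
      assume "d \<le> i"
      then show ?thesis using U dim_ge finite_subset[OF U(1) finT] by simp
    qed
    then show "(\<Sum>m\<in>U. z m) \<le> real (pdim (pspan (mpol_of_monom ` U \<union> G i))) - real (pdim (G i))"
      by (rule dim_constraint_trivial[OF G_sub that(2)])
  qed
  \<comment> \<open>An intermediate system in the coordinates of \<open>L\<close>, still written
    with the graded pieces of the ideal. It separates the change of coordinates from the rewriting
    of the constraints.\<close>
  define R where "R = {z \<in> L \<rightarrow>\<^sub>E {0..1::real}.
      (\<forall>m1 \<in> L. \<forall>m2 \<in> L. mdvd m1 m2 \<longrightarrow> z m1 \<ge> z m2)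
    \<and> (\<forall>i\<le>d. (\<Sum>m\<in>T i. z m) = real (card (T i)) - real (pdim (G i)))
    \<and> (\<forall>i\<in>{1..d - 1}. bounded z i)}"
  have on_eq: "order_ideal_polytope_on n M L = R"
  proof (intro equalityI subsetI)
    fix w assume "w \<in> order_ideal_polytope_on n M L"
    then obtain z where z: "z \<in> order_ideal_polytope n (ideal_gen n M)" "w = restrict z L"
      by (auto simp: order_ideal_polytope_on_def)
    have w_z: "w m = z m" if "m \<in> T i" "i \<le> d" for i m
      using that TL by (auto simp: z(2))
    have "(\<Sum>m\<in>T i. w m) = (\<Sum>m\<in>T i. z m)" if "i \<le> d" for i
      using w_z that by (intro sum.cong) auto
    moreover have "bounded w i \<longleftrightarrow> bounded z i" if "i \<le> d" for i
      using w_z that by (intro bounded_cong) auto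
    ultimately show "w \<in> R"
      using z LM unfolding R_def polytope by (auto simp: PiE_iff subset_iff)
  next
    fix w assume w: "w \<in> R"
    \<comment> \<open>Extension by zero. It keeps monotonicity because \<open>L\<close> is closed
      under divisors and all values are nonnegative; beyond degree \<open>d\<close> both sides of
      the equalities are 0.\<close>
    define z where "z = restrict (\<lambda>m. if m \<in> L then w m else 0) (monoms n)"
    have z_w: "z m = w m" if "m \<in> L" for m
      using that LM by (auto simp: z_def)
    have w01: "0 \<le> w m \<and> w m \<le> 1" if "m \<in> L" for m
      using w that by (auto simp: R_def PiE_iff)
    have "restrict z L = w"
      using w z_w by (auto simp: R_def PiE_iff extensional_def)
    moreover have "z \<in> order_ideal_polytope n (ideal_gen n M)"
      unfolding polytope
    proof (intro CollectI conjI ballI allI impI)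
      show "z \<in> monoms n \<rightarrow>\<^sub>E {0..1}"
        using w01 by (auto simp: z_def)
      show "z m2 \<le> z m1" if m: "m1 \<in> monoms n" "m2 \<in> monoms n" "mdvd m1 m2" for m1 m2
      proof (cases "m2 \<in> L")
        case True
        moreover have "m1 \<in> L"
          using True m by (auto simp: L monoms_le_def mdvd_def mdeg_add)
        ultimately show ?thesis using w m(3) z_w by (auto simp: R_def)
      next
        case False
        then show ?thesis using m w01 by (auto simp: z_def)
      qed
      show sum_z: "(\<Sum>m\<in>T i. z m) = real (card (T i)) - real (pdim (G i))" for i
      proof (cases "i \<le> d")
        case True
        then have "(\<Sum>m\<in>T i. z m) = (\<Sum>m\<in>T i. w m)"
          using TL z_w by (intro sum.cong) auto
        then show ?thesis using True w by (auto simp: R_def)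
      next
        case False
        then have "z m = 0" if "m \<in> T i" for m
          using that by (auto simp: z_def T_def monoms_eq_def L monoms_le_def)
        then show ?thesis using False dim_ge[of i] by simp
      qed
      show "bounded z i" for i
      proof (cases "i \<in> {1..d - 1}")
        case True
        then have "i \<le> d" by auto
        then have "bounded z i = bounded w i"
          using TL z_w by (intro bounded_cong) blast
        then show ?thesis using True w by (auto simp: R_def)
      next
        case False
        then show ?thesis by (intro bounded_outer sum_z) auto
      qed
    qed
    ultimately show "w \<in> order_ideal_polytope_on n M L"
      unfolding order_ideal_polytope_on_def by blast
  qed
  have sums: "(\<forall>i\<le>d. (\<Sum>m\<in>T i. z m) = real (card (T i)) - real (pdim (G i))) \<longleftrightarrow>
      (\<forall>i\<in>{0..d}. (\<Sum>m \<in> degree_part L i. z m) =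
        real (pdim (pspan (mpol_of_monom ` degree_part L i) :: 'a mpol set))
        - real (pdim (pspan (leading_form ` Ms i))))" for z
    unfolding dim_span_monoms using part G_le by auto
  have ranks: "bounded z i \<longleftrightarrow> (\<forall>U\<subseteq>degree_part L i. card U = pdim (pspan (leading_form ` Ms i)) \<longrightarrow>
        (\<Sum>m\<in>U. z m) \<ge> real (card U) - real (mat_rank (leading_form ` Ms i) U Poly_Mapping.lookup))"
      if "\<forall>i\<le>d. (\<Sum>m\<in>T i. z m) = real (card (T i)) - real (pdim (G i))" "i \<in> {1..d - 1}" for z i
  proof -
    have "i \<le> d" using that(2) by auto
    then show ?thesis using that(1) bounded_rank[of i z] G_le part by simp
  qed
  show ?thesis
    \<comment> \<open>The congruence rules let the sum equalities be assumed while the rank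
      constraints are rewritten, since complementing \<open>U\<close> depends on them.\<close>
    unfolding on_eq R_def
    by (rule Collect_cong, rule conj_cong[OF refl], rule conj_cong[OF refl], rule conj_cong[OF sums],
        rule ball_cong[OF refl], rule ranks[OF sums[THEN iffD2]])
qed

end
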